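(* Let $\mu$ be a probability measure in $P_2(\mathbb{R}^n)$ with density $e^{-V}$, where $V:\mathbb{R}^n\to\mathbb{R}$ is a $\mathcal C^2$ function satisfying $\mathrm{Hess}(V)\ge R\,\mathrm{Id}_n$ with $R>0$. Let $A\subset\mathbb{R}^n$ be a measurable set with $\mu(A)>0$, let $r>0$ and $$A_r=\{x\in\mathbb{R}^n:\ \forall y\in A,\ |y-x|>r\},$$ and assume $\mu(A_r)>0$. Let $c_A=\sqrt{2R^{-1}\log(1/\mu(A))}$, $c_V=\int V\,d\mu$ and $V_r=\int V\,d\mu_{A_r}$, where $\mu_{A_r}=\frac{1_{A_r}}{\mu(A_r)}\mu$. Then for $r>c_A$, $$\mu(A_r)\le e^{c_V-V_r}\Big[1+\frac1n\Big(V_r-c_V-\frac R2(r-c_A)^2\Big)\Big]^n.$$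
   Context: $P_2(\mathbb{R}^n)$ is the set of probability measures on $\mathbb{R}^n$ with finite second moment. Densities are with respect to Lebesgue measure; $\mathrm{Hess}(V)\ge R\,\mathrm{Id}_n$ is meant pointwise as symmetric matrices; $|\cdot|$ is the Euclidean norm. *)

theory Defs
  imports "HOL-Analysis.Analysis" "HOL-Probability.Probability"
begin

definition P2 :: "(real ^ 'n) measure set" where
  "P2 = {\<mu>. prob_space \<mu> \<and> sets \<mu> = sets borel \<and> integrable \<mu> (\<lambda>x. (norm x)\<^sup>2)}"

definition grad :: "(real ^ 'n \<Rightarrow> real) \<Rightarrow> real ^ 'n \<Rightarrow> real ^ 'n" where
  "grad f x = (\<chi> i. frechet_derivative f (at x) (axis i 1))"

(* Only meaningful where f is twice differentiable; C2 below guarantees this everywhere. *)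
definition Hess :: "(real ^ 'n \<Rightarrow> real) \<Rightarrow> real ^ 'n \<Rightarrow> real ^ 'n ^ 'n" where
  "Hess f x = jacobian (grad f) (at x)"

definition C2 :: "(real ^ 'n \<Rightarrow> real) \<Rightarrow> bool" where
  "C2 f \<longleftrightarrow>
     (\<forall>x. f differentiable (at x)) \<and>
     (\<forall>x. grad f differentiable (at x)) \<and>
     continuous_on UNIV (Hess f)"

(* The order on symmetric matrices: B - A is positive semidefinite. Symmetry is not part of
   the definition; the Hessian of a C2 function is symmetric by Schwarz's theorem. *)
definition loewner_le :: "real ^ 'n ^ 'n \<Rightarrow> real ^ 'n ^ 'n \<Rightarrow> bool" where
  "loewner_le A B \<longleftrightarrow> (\<forall>v. 0 \<le> v \<bullet> ((B - A) *v v))"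

(* The complement is the sum of A and a closed ball, hence analytic for Borel A. So the set is
   always Lebesgue measurable, but Borel measurability is not automatic; its mass and the
   conditional measure on it are therefore taken with respect to the completion of the
   Borel measure. *)
definition far_set :: "(real ^ 'n) set \<Rightarrow> real \<Rightarrow> (real ^ 'n) set" where
  "far_set A r = {x. \<forall>y\<in>A. norm (y - x) > r}"

end

theory Submission
  imports Defs
begin

text \<open>
Let \<open>\<nu>\<close> be \<open>\<mu>\<close> conditioned on \<open>A\<^sub>r\<close>, and \<open>D = V\<^sub>r - c\<^sub>V\<close>. In terms of optimal transport, the estimate
combines two facts. Strong convexity of \<open>V\<close> along a transport map \<open>T\<close> from \<open>\<mu>\<close> to \<open>\<nu>\<close>, the change of
variables formula and \<open>n det(DT)\<^sup>1\<^sup>/\<^sup>n \<le> tr DT\<close> give the dimensional inequality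
\<open>ln \<mu>(A\<^sub>r) + D \<le> n ln (1 + (D - R/2 W\<^sup>2)/n)\<close>, where \<open>W\<close> is the Wasserstein distance of \<open>\<mu>\<close> and \<open>\<nu>\<close>. And
\<open>W \<ge> r - c\<^sub>A\<close>, because \<open>\<nu>\<close> is at distance at least \<open>r\<close> from \<open>\<mu>\<close> conditioned on \<open>A\<close>, which is within \<open>c\<^sub>A\<close>
of \<open>\<mu>\<close> by Talagrand's inequality.

The proof below is the dual of this argument and uses no transport maps. Both inequalities come from
\<open>dual_transport_inequality\<close>: if \<open>f z + R/2 |y - z|\<^sup>2 \<ge> q\<close> for all \<open>y \<in> S\<close> and all \<open>z\<close>, then
\<open>ln \<mu>(S) + (1 - \<kappa>) (V\<^sub>S - c\<^sub>V) \<le> \<kappa> (\<integral> f d\<mu> - q) + n (\<kappa> - 1 - ln \<kappa>)\<close> for every \<open>\<kappa> > 0\<close>, where \<open>V\<^sub>S\<close> is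
the mean of \<open>V\<close> over \<open>S\<close>. This is a derivative at \<open>t = 0\<close> of the Prekopa-Leindler inequality in the rescaled
form \<open>prekopa_leindler\<close>, where the points are combined with weights \<open>1 - \<kappa> t\<close> and \<open>\<kappa> t\<close> but the
functions with exponents \<open>1 - t\<close> and \<open>t\<close>. The dilation parameter \<open>\<kappa>\<close> produces the dependence on the
dimension.

The test functions are multiples of \<open>\<phi> = R/2 d(\<cdot>,A)\<^sup>2\<close>, capped at a constant. With \<open>S = A\<close>, \<open>f = - \<phi>\<close>
and \<open>\<kappa> = 1\<close> the inequality says \<open>\<integral> \<phi> d\<mu> \<le> ln (1/\<mu>(A)) = R/2 c\<^sub>A\<^sup>2\<close>. With \<open>S = A\<^sub>r\<close> and \<open>f = \<theta> \<phi>\<close> one can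
take \<open>q = R/2 \<theta>/(1 + \<theta>) r\<^sup>2\<close>, and \<open>\<theta> = r/c\<^sub>A - 1\<close> turns \<open>q - \<integral> f d\<mu>\<close> into at least
\<open>R/2 (r - c\<^sub>A)\<^sup>2\<close>. Minimising over \<open>\<kappa>\<close> gives the logarithm of the claim.
\<close>

section \<open>The Brunn-Minkowski inequality on the real line\<close>

lemma emeasure_lborel_compact_inner:
  fixes C :: "real set"
  assumes C: "C \<in> sets borel" and "C \<noteq> {}"
  shows "emeasure lborel C = (SUP K\<in>{K. compact K \<and> K \<noteq> {} \<and> K \<subseteq> C}. emeasure lborel K)"
    (is "_ = ?S")
proof (rule antisym)
  obtain c where c: "c \<in> C" using assms by blast
  show "?S \<le> emeasure lborel C"
    using C by (intro SUP_least emeasure_mono) auto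
  show "emeasure lborel C \<le> ?S"
  proof (rule ennreal_le_epsilon)
    fix e :: real assume "0 < e"
    have "C \<in> sets lebesgue" using C by simp
    then obtain T where T: "closed T" "T \<subseteq> C" "emeasure lebesgue (C - T) < ennreal e"
      using sets_lebesgue_inner_closed[OF _ \<open>0 < e\<close>] by metis
    have Tb: "T \<in> sets borel" using T by simp
    \<comment> \<open>Adjoining \<open>c\<close> keeps the compact sets nonempty.\<close>
    define K where "K N = insert c (T \<inter> cball 0 (real N))" for N :: nat
    have K: "compact (K N)" "K N \<noteq> {}" "K N \<subseteq> C" for N
      using T c by (auto simp: K_def intro!: compact_insert closed_Int_compact)
    have "incseq K" by (force simp: K_def incseq_def)
    moreover have "K N \<in> sets lborel" for N using K(1)[of N] by (simp add: compact_imp_closed)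
    ultimately have "(SUP N. emeasure lborel (K N)) = emeasure lborel (\<Union>N. K N)"
      by (intro SUP_emeasure_incseq) auto
    moreover have "T \<subseteq> (\<Union>N. K N)"
    proof
      fix x assume "x \<in> T"
      then have "x \<in> K (nat \<lceil>norm x\<rceil>)" by (auto simp: K_def)
      then show "x \<in> (\<Union>N. K N)" by blast
    qed
    moreover have "(\<Union>N. K N) \<in> sets lborel"
      using \<open>\<And>N. K N \<in> sets lborel\<close> by blast
    ultimately have "emeasure lborel T \<le> (SUP N. emeasure lborel (K N))"
      by (simp add: emeasure_mono)
    also have "\<dots> \<le> ?S"
      using K by (intro SUP_mono) blast
    finally have 1: "emeasure lborel T \<le> ?S" .
    have "emeasure lborel C = emeasure lborel T + emeasure lborel (C - T)"
      using C Tb T(2) by (subst plus_emeasure) (auto simp: Un_absorb1)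
    also have "\<dots> \<le> ?S + ennreal e"
      using T(3) 1 C Tb by (intro add_mono) (auto simp: less_imp_le)
    finally show "emeasure lborel C \<le> ?S + ennreal e" .
  qed
qed

lemma emeasure_lborel_affine_image:
  fixes K :: "real set"
  assumes "compact K" "p > 0"
  shows "emeasure lborel ((\<lambda>x. t + p * x) ` K) = ennreal p * emeasure lborel K"
proof -
  have "compact ((\<lambda>x. t + p * x) ` K)"
    using assms by (intro compact_continuous_image continuous_intros)
  then have [measurable]: "(\<lambda>x. t + p * x) ` K \<in> sets borel" "K \<in> sets borel"
    using assms by (simp_all add: borel_compact)
  have "emeasure lborel ((\<lambda>x. t + p * x) ` K)
      = (\<integral>\<^sup>+x. indicator ((\<lambda>x. t + p * x) ` K) x \<partial>lborel)" by simp
  also have "\<dots> = ennreal p * (\<integral>\<^sup>+x. indicator ((\<lambda>x. t + p * x) ` K) (t + p * x) \<partial>lborel)"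
    using assms by (subst nn_integral_real_affine[where c = p and t = t]) auto
  also have "(\<lambda>x. indicator ((\<lambda>x. t + p * x) ` K) (t + p * x) :: ennreal) = indicator K"
    using assms by (auto simp: indicator_def fun_eq_iff)
  finally show ?thesis by simp
qed

text \<open>
If \<open>k\<close> is the maximum of \<open>K\<close> and \<open>l\<close> the minimum of \<open>L\<close>, then \<open>p K + q L\<close> contains the scaled
translates \<open>p K + q l\<close> and \<open>p k + q L\<close>. The first lies to the left of \<open>p k + q l\<close> and the second to
its right, so they share a single point and their measures add up.
\<close>

lemma brunn_minkowski_compact:
  fixes K L E :: "real set"
  assumes K: "compact K" "K \<noteq> {}" and L: "compact L" "L \<noteq> {}" and E: "E \<in> sets borel"
    and p: "p > 0" and q: "q > 0"
    and sub: "\<And>x y. x \<in> K \<Longrightarrow> y \<in> L \<Longrightarrow> p * x + q * y \<in> E"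
  shows "ennreal p * emeasure lborel K + ennreal q * emeasure lborel L \<le> emeasure lborel E"
proof -
  obtain k where k: "k \<in> K" "\<And>x. x \<in> K \<Longrightarrow> x \<le> k"
    using compact_attains_sup[OF K] by blast
  obtain l where l: "l \<in> L" "\<And>x. x \<in> L \<Longrightarrow> l \<le> x"
    using compact_attains_inf[OF L] by blast
  define F where "F = (\<lambda>x. q * l + p * x) ` K"
  define G where "G = (\<lambda>y. p * k + q * y) ` L"
  have "compact F" "compact G"
    unfolding F_def G_def using K L by (auto intro!: compact_continuous_image continuous_intros)
  then have [measurable]: "F \<in> sets borel" "G \<in> sets borel"
    by (simp_all add: borel_compact)
  have "F \<inter> G \<subseteq> {p * k + q * l}"
  proof
    fix z assume "z \<in> F \<inter> G"
    then obtain x y where xy: "x \<in> K" "y \<in> L" "z = q * l + p * x" "z = p * k + q * y"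
      by (auto simp: F_def G_def)
    have "p * x \<le> p * k" "q * l \<le> q * y" using k l xy p q by auto
    with xy have "p * x = p * k" by linarith
    then show "z \<in> {p * k + q * l}" using xy by simp
  qed
  then have "emeasure lborel (F \<inter> G) \<le> emeasure lborel {p * k + q * l}"
    by (intro emeasure_mono) auto
  then have 0: "emeasure lborel (F \<inter> G) = 0" by simp
  have "ennreal p * emeasure lborel K + ennreal q * emeasure lborel L
      = emeasure lborel F + emeasure lborel G"
    unfolding F_def G_def using K L p q by (simp add: emeasure_lborel_affine_image)
  also have "\<dots> = emeasure lborel (F \<union> G)"
    using emeasure_Un'[of F lborel G] 0 by (simp add: null_sets_def)
  also have "\<dots> \<le> emeasure lborel E"
    using E sub k l by (intro emeasure_mono) (auto simp: F_def G_def add.commute)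
  finally show ?thesis .
qed

text \<open>
Inner regularity reduces the claim to compact sets. The measurable superset \<open>E\<close> takes the place of
the sum set, which need not be a Borel set.
\<close>

lemma brunn_minkowski_real:
  fixes C D E :: "real set"
  assumes C: "C \<in> sets borel" "C \<noteq> {}" and D: "D \<in> sets borel" "D \<noteq> {}" and E: "E \<in> sets borel"
    and p: "p > 0" and q: "q > 0"
    and sub: "\<And>x y. x \<in> C \<Longrightarrow> y \<in> D \<Longrightarrow> p * x + q * y \<in> E"
  shows "ennreal p * emeasure lborel C + ennreal q * emeasure lborel D \<le> emeasure lborel E"
proof -
  let ?I = "\<lambda>C. {K. compact K \<and> K \<noteq> {} \<and> K \<subseteq> C}"
  have ne: "?I C \<noteq> {}" if "C \<noteq> {}" for C :: "real set"
  proof -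
    from that obtain c where "c \<in> C" by blast
    then have "{c} \<in> ?I C" by simp
    then show ?thesis by blast
  qed
  have "ennreal p * emeasure lborel C + ennreal q * emeasure lborel D
      = (SUP K\<in>?I C. ennreal p * emeasure lborel K) + (SUP L\<in>?I D. ennreal q * emeasure lborel L)"
    using emeasure_lborel_compact_inner[OF C] emeasure_lborel_compact_inner[OF D]
    by (simp add: SUP_mult_left_ennreal)
  also have "\<dots> = (SUP K\<in>?I C. ennreal p * emeasure lborel K
      + (SUP L\<in>?I D. ennreal q * emeasure lborel L))"
    by (rule ennreal_SUP_add_left[OF ne[OF C(2)], symmetric])
  also have "\<dots> = (SUP K\<in>?I C. SUP L\<in>?I D. ennreal p * emeasure lborel K + ennreal q * emeasure lborel L)"
    by (intro SUP_cong refl ennreal_SUP_add_right[OF ne[OF D(2)]])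
  also have "\<dots> \<le> emeasure lborel E"
    using sub by (intro SUP_least brunn_minkowski_compact[OF _ _ _ _ E p q]) auto
  finally show ?thesis .
qed

text \<open>
The level is written as a fraction \<open>r\<close> of a cap \<open>U\<close>, so that the level sets of functions with
different suprema are compared at the same \<open>r\<close>.
\<close>

lemma nn_integral_layer_cake:
  fixes f :: "real \<Rightarrow> ennreal"
  assumes [measurable]: "f \<in> borel_measurable borel" and U: "U > 0"
  shows "(\<integral>\<^sup>+x. min (f x) (ennreal U) \<partial>lborel)
    = ennreal U * (\<integral>\<^sup>+r\<in>{0<..<1}. emeasure lborel {x. ennreal (r * U) < f x} \<partial>lborel)"
proof -
  have *: "min (f x) (ennreal U)
      = ennreal U * (\<integral>\<^sup>+r. indicator {0<..<1} r * indicator {x. ennreal (r * U) < f x} x \<partial>lborel)"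
    (is "_ = _ * ?J") for x
  proof (cases "f x")
    case (real a)
    have "?J = (\<integral>\<^sup>+r. indicator {0<..<min 1 (a/U)} r \<partial>lborel)"
      using U real by (intro nn_integral_cong)
        (auto simp: indicator_def ennreal_less_iff field_simps)
    also have "\<dots> = ennreal (min 1 (a / U))" using real U by simp
    also have "ennreal U * \<dots> = ennreal (U * min 1 (a/U))"
      using U real by (simp add: ennreal_mult)
    also have "U * min 1 (a/U) = min a U" using U by (auto simp: min_def field_simps)
    finally show ?thesis using real U by (simp add: min_def ennreal_le_iff)
  next
    case top
    have "?J = (\<integral>\<^sup>+r. indicator {0<..<1::real} r \<partial>lborel)"
      using top by (intro nn_integral_cong) (auto simp: indicator_def)
    then show ?thesis using top by simp
  qed
  have m0: "(\<lambda>p. indicator {0<..<1} (fst p) * indicator {p. ennreal (fst p * U) < f (snd p)} p :: ennreal)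
      \<in> borel_measurable (borel \<Otimes>\<^sub>M borel)"
    "(\<lambda>p. indicator {0<..<1} (snd p) * indicator {p. ennreal (snd p * U) < f (fst p)} p :: ennreal)
      \<in> borel_measurable (borel \<Otimes>\<^sub>M borel)"
    by measurable
  have m: "(\<lambda>(r, x). indicator {0<..<1} r * indicator {x. ennreal (r * U) < f x} x :: ennreal)
      \<in> borel_measurable (lborel \<Otimes>\<^sub>M lborel)"
    "(\<lambda>(x, r). indicator {0<..<1} r * indicator {x. ennreal (r * U) < f x} x :: ennreal)
      \<in> borel_measurable (lborel \<Otimes>\<^sub>M lborel)"
    using m0 by (simp_all add: case_prod_beta indicator_def cong: measurable_cong_sets)
  have "(\<integral>\<^sup>+x. min (f x) (ennreal U) \<partial>lborel)
     = ennreal U * (\<integral>\<^sup>+x. \<integral>\<^sup>+r. indicator {0<..<1} r * indicator {x. ennreal (r * U) < f x} x \<partial>lborel \<partial>lborel)"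
    unfolding * by (intro nn_integral_cmult lborel.borel_measurable_nn_integral m(2))
  also have "(\<integral>\<^sup>+x. \<integral>\<^sup>+r. indicator {0<..<1} r * indicator {x. ennreal (r * U) < f x} x \<partial>lborel \<partial>lborel)
     = (\<integral>\<^sup>+r. \<integral>\<^sup>+x. indicator {0<..<1} r * indicator {x. ennreal (r * U) < f x} x \<partial>lborel \<partial>lborel)"
    by (rule lborel_pair.Fubini'[OF m(1)])
  also have "\<dots> = (\<integral>\<^sup>+r\<in>{0<..<1}. emeasure lborel {x. ennreal (r * U) < f x} \<partial>lborel)"
    by (intro nn_integral_cong) (simp add: nn_integral_cmult mult.commute)
  finally show ?thesis .
qed

section \<open>A rescaled Prekopa-Leindler inequality\<close>

text \<open>
This is the inequality \<open>c A\<^sup>1\<^sup>-\<^sup>t B\<^sup>t \<le> C\<close> for extended nonnegative numbers, with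
\<open>0 \<cdot> \<infinity> = 0\<close>. Testing it on reals strictly below \<open>A\<close> and \<open>B\<close> spares powers of \<open>\<infinity>\<close>, which the
marginals in the induction on the dimension can attain, and makes it stable under increasing limits
in \<open>A\<close> and \<open>B\<close>.
\<close>

definition geo_le :: "real \<Rightarrow> real \<Rightarrow> ennreal \<Rightarrow> ennreal \<Rightarrow> ennreal \<Rightarrow> bool" where
  "geo_le c t A B C \<longleftrightarrow>
     (\<forall>a b. 0 < a \<longrightarrow> 0 < b \<longrightarrow> ennreal a < A \<longrightarrow> ennreal b < B \<longrightarrow>
        ennreal (c * (a powr (1 - t) * b powr t)) \<le> C)"

lemma geo_leD:
  "geo_le c t A B C \<Longrightarrow> 0 < a \<Longrightarrow> 0 < b \<Longrightarrow> ennreal a < A \<Longrightarrow> ennreal b < B \<Longrightarrow>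
    ennreal (c * (a powr (1 - t) * b powr t)) \<le> C"
  by (simp add: geo_le_def)

lemma geo_le_imp_le:
  assumes "geo_le c t A B C" "0 < a" "0 < b" "ennreal a \<le> A" "ennreal b \<le> B"
  shows "ennreal (c * (a powr (1 - t) * b powr t)) \<le> C"
proof (cases C)
  case (real C')
  have "c * (a powr (1 - t) * b powr t) \<le> C'"
  proof (rule field_le_mult_one_interval)
    fix r :: real assume r: "0 < r" "r < 1"
    have "ennreal (r * a) < ennreal a" "ennreal (r * b) < ennreal b"
      using r assms(2,3) by (auto simp: ennreal_less_iff)
    then have "ennreal (c * ((r * a) powr (1 - t) * (r * b) powr t)) \<le> C"
      using assms r by (intro geo_leD[OF assms(1)]) (auto intro: less_le_trans)
    also have "c * ((r * a) powr (1 - t) * (r * b) powr t) = r * (c * (a powr (1 - t) * b powr t))"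
      using r assms(2,3) by (simp add: powr_mult powr_diff field_simps)
    finally show "r * (c * (a powr (1 - t) * b powr t)) \<le> C'"
      using real by (simp add: ennreal_le_iff)
  qed
  then show ?thesis using real by (simp add: ennreal_leI)
qed simp

lemma ennreal_dense_real:
  assumes "0 \<le> a" "ennreal a < A"
  obtains a' where "a < a'" "ennreal a' < A"
proof -
  from assms(2) obtain B where B: "ennreal a < B" "B < A" using dense by blast
  then obtain b where "B = ennreal b" "0 \<le> b" by (cases B) auto
  with B assms that show ?thesis by (auto simp: ennreal_less_iff)
qed

text \<open>
A cap \<open>U\<close> which leaves the integral above \<open>a\<close> and is the exact supremum of the capped function: all
level sets at fractions \<open>r < 1\<close> of \<open>U\<close> are then nonempty, as Brunn-Minkowski requires.
\<close>

lemma nn_integral_truncation_height: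
  fixes u :: "real \<Rightarrow> ennreal"
  assumes [measurable]: "u \<in> borel_measurable borel"
    and a: "0 < a" "ennreal a < (\<integral>\<^sup>+x. u x \<partial>lborel)"
  obtains U where "0 < U" "ennreal a < (\<integral>\<^sup>+x. min (u x) (ennreal U) \<partial>lborel)"
    "\<And>r. 0 < r \<Longrightarrow> r < 1 \<Longrightarrow> \<exists>x. ennreal (r * U) < u x"
proof -
  have "(\<integral>\<^sup>+x. u x \<partial>lborel) = (\<integral>\<^sup>+x. (SUP N. min (u x) (of_nat N)) \<partial>lborel)"
  proof (intro nn_integral_cong)
    fix x
    have "(SUP N. min (u x) (of_nat N :: ennreal)) = min (u x) (SUP N. of_nat N)"
      using inf_SUP[of "u x" "\<lambda>N. of_nat N :: ennreal" UNIV] by (simp add: inf_min)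
    then show "u x = (SUP N. min (u x) (of_nat N))"
      by (simp add: ennreal_SUP_of_nat_eq_top)
  qed
  also have "\<dots> = (SUP N. \<integral>\<^sup>+x. min (u x) (of_nat N) \<partial>lborel)"
    by (intro nn_integral_monotone_convergence_SUP)
       (auto simp: incseq_def le_fun_def intro: min.coboundedI2 of_nat_mono)
  finally obtain N where N: "ennreal a < (\<integral>\<^sup>+x. min (u x) (of_nat N) \<partial>lborel)"
    using a by (auto simp: less_SUP_iff)
  define S where "S = (SUP x. min (u x) (of_nat N))"
  have "S \<le> of_nat N" unfolding S_def by (intro SUP_least) simp
  then have fin: "S < top" by (rule le_less_trans[OF _ of_nat_less_top])
  have up: "min (u x) (of_nat N) \<le> S" for x unfolding S_def by (rule SUP_upper) simp
  have Spos: "S \<noteq> 0"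
  proof
    assume "S = 0"
    then have "min (u x) (of_nat N) = 0" for x using up[of x] by simp
    then show False using N by simp
  qed
  define U where "U = enn2real S"
  have SU: "S = ennreal U" using fin by (simp add: U_def)
  have U: "0 < U" using Spos SU by (metis ennreal_neg not_less)
  have eq: "min (u x) (ennreal U) = min (u x) (of_nat N)" for x
  proof (rule antisym)
    show "min (u x) (ennreal U) \<le> min (u x) (of_nat N)"
      using \<open>S \<le> of_nat N\<close> unfolding SU by (rule min.mono[OF order_refl])
    show "min (u x) (of_nat N) \<le> min (u x) (ennreal U)"
      using up[of x] unfolding SU by simp
  qed
  show ?thesis
  proof
    show "0 < U" by fact
    show "ennreal a < (\<integral>\<^sup>+x. min (u x) (ennreal U) \<partial>lborel)" using N by (simp add: eq)
    fix r :: real assume "0 < r" "r < 1"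
    then have "ennreal (r * U) < S" using U by (simp add: SU ennreal_less_iff)
    then obtain x where "ennreal (r * U) < min (u x) (of_nat N)"
      unfolding S_def by (auto simp: less_SUP_iff)
    then show "\<exists>x. ennreal (r * U) < u x" by auto
  qed
qed

lemma weighted_geometric_mean_le:
  fixes X Y p q t :: real
  assumes t: "0 < t" "t < 1" and "p > 0" "q > 0" "X > 0" "Y > 0"
  shows "(p / (1 - t)) powr (1 - t) * (q / t) powr t * (X powr (1 - t) * Y powr t) \<le> p * X + q * Y"
proof -
  have "(p / (1 - t) * X) powr (1 - t) * (q / t * Y) powr t \<le> (1 - t) * (p / (1 - t) * X) + t * (q / t * Y)"
    using assms by (intro Youngs_inequality_0) auto
  also have "\<dots> = p * X + q * Y" using t by simp
  finally have "(p / (1 - t) * X) powr (1 - t) * (q / t * Y) powr t \<le> p * X + q * Y" .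
  moreover have "(p / (1 - t) * X) powr (1 - t) = (p / (1 - t)) powr (1 - t) * X powr (1 - t)"
    "(q / t * Y) powr t = (q / t) powr t * Y powr t"
    by (subst powr_mult; use assms in simp)+
  ultimately show ?thesis by (simp add: mult_ac)
qed

text \<open>
Cap \<open>u\<close> and \<open>v\<close> at their heights \<open>U\<close> and \<open>V\<close>. The sum set of the level sets of \<open>u\<close> and \<open>v\<close> at
fraction \<open>r\<close> lies in the level set of \<open>h\<close> at fraction \<open>r\<close> of \<open>W = c U\<^sup>1\<^sup>-\<^sup>t V\<^sup>t\<close>. Brunn-Minkowski and
integration over \<open>r\<close> bound the integral of \<open>h\<close> below by \<open>W (p I / U + q J / V)\<close>, where \<open>I\<close> and \<open>J\<close> are
the integrals of the capped functions, and the weighted arithmetic-geometric mean inequality finishes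
the proof. The case \<open>c = 1\<close>, \<open>p = 1 - t\<close>, \<open>q = t\<close> is the usual Prekopa-Leindler inequality; the freedom
in \<open>p\<close> and \<open>q\<close> amounts to dilating \<open>u\<close> and \<open>v\<close>.
\<close>

lemma prekopa_leindler_real:
  fixes u v h :: "real \<Rightarrow> ennreal"
  assumes [measurable]: "u \<in> borel_measurable borel" "v \<in> borel_measurable borel" "h \<in> borel_measurable borel"
    and t: "0 < t" "t < 1" and p: "p > 0" and q: "q > 0" and c: "c > 0"
    and uvh: "\<And>x y. geo_le c t (u x) (v y) (h (p * x + q * y))"
  shows "geo_le (c * ((p / (1 - t)) powr (1 - t) * (q / t) powr t)) t
    (\<integral>\<^sup>+x. u x \<partial>lborel) (\<integral>\<^sup>+x. v x \<partial>lborel) (\<integral>\<^sup>+x. h x \<partial>lborel)"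
  unfolding geo_le_def
proof (intro allI impI)
  fix a b assume a: "0 < a" "ennreal a < (\<integral>\<^sup>+x. u x \<partial>lborel)"
    and b: "0 < b" "ennreal b < (\<integral>\<^sup>+x. v x \<partial>lborel)"
  obtain U where U: "0 < U" "ennreal a < (\<integral>\<^sup>+x. min (u x) (ennreal U) \<partial>lborel)"
    "\<And>r. 0 < r \<Longrightarrow> r < 1 \<Longrightarrow> \<exists>x. ennreal (r * U) < u x"
    using nn_integral_truncation_height[OF _ a] by auto
  obtain V where V: "0 < V" "ennreal b < (\<integral>\<^sup>+x. min (v x) (ennreal V) \<partial>lborel)"
    "\<And>r. 0 < r \<Longrightarrow> r < 1 \<Longrightarrow> \<exists>x. ennreal (r * V) < v x"
    using nn_integral_truncation_height[OF _ b] by auto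
  define W where "W = c * (U powr (1 - t) * V powr t)"
  have W: "0 < W" using c U(1) V(1) by (simp add: W_def)
  let ?C = "\<lambda>r. {x. ennreal (r * U) < u x}" and ?D = "\<lambda>r. {x. ennreal (r * V) < v x}"
  let ?E = "\<lambda>r. {x. ennreal (r * W) < h x}"
  have level: "ennreal p * emeasure lborel (?C r) + ennreal q * emeasure lborel (?D r)
      \<le> emeasure lborel (?E r)" if r: "0 < r" "r < 1" for r
  proof (rule brunn_minkowski_real[OF _ _ _ _ _ p q])
    show "?C r \<noteq> {}" "?D r \<noteq> {}" using U(3)[OF r] V(3)[OF r] by auto
    fix x y assume "x \<in> ?C r" "y \<in> ?D r"
    then have x: "ennreal (r * U) < u x" and y: "ennreal (r * V) < v y" by auto
    have "0 < r * U" "0 < r * V" using r U V by auto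
    \<comment> \<open>A value strictly between \<open>r * U\<close> and \<open>u x\<close> makes the resulting inequality for \<open>h\<close> strict.\<close>
    obtain a' where a': "r * U < a'" "ennreal a' < u x"
      using ennreal_dense_real[OF _ x] \<open>0 < r * U\<close> by auto
    have "r * W = c * ((r * U) powr (1 - t) * (r * V) powr t)"
      using r U(1) V(1) by (simp add: W_def powr_mult powr_diff field_simps)
    also have "\<dots> < c * (a' powr (1 - t) * (r * V) powr t)"
      using c a' \<open>0 < r * U\<close> \<open>0 < r * V\<close> t
      by (intro mult_strict_left_mono mult_strict_right_mono powr_less_mono2) auto
    finally have "ennreal (r * W) < ennreal (c * (a' powr (1 - t) * (r * V) powr t))"
      using r W by (subst ennreal_less_iff) auto
    also have "\<dots> \<le> h (p * x + q * y)"
      using uvh a' y \<open>0 < r * U\<close> \<open>0 < r * V\<close> by (intro geo_leD) auto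
    finally show "p * x + q * y \<in> ?E r" by simp
  qed measurable
  define IU where "IU = (\<integral>\<^sup>+r\<in>{0<..<1}. emeasure lborel (?C r) \<partial>lborel)"
  define IV where "IV = (\<integral>\<^sup>+r\<in>{0<..<1}. emeasure lborel (?D r) \<partial>lborel)"
  have lem: "ennreal (a / U) < I" if "ennreal a < ennreal U * I" "0 < a" "0 < U" for a U I
  proof (cases I)
    case (real i)
    with that have "a < U * i" by (simp add: ennreal_mult'[symmetric] ennreal_less_iff)
    then show ?thesis using real that by (simp add: ennreal_less_iff field_simps)
  qed simp
  have IU: "ennreal (a / U) < IU" and IV: "ennreal (b / V) < IV"
    using U V a b by (auto simp: IU_def IV_def nn_integral_layer_cake intro!: lem)
  have m: "(\<lambda>r. emeasure lborel {x. ennreal (r * M) < f x}) \<in> borel_measurable lborel"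
    if [measurable]: "f \<in> borel_measurable borel" for f :: "real \<Rightarrow> ennreal" and M
  proof -
    have "{p \<in> space (borel \<Otimes>\<^sub>M borel). ennreal (fst p * M) < f (snd p)} \<in> sets (borel \<Otimes>\<^sub>M borel)"
      by measurable
    then have "{p. ennreal (fst p * M) < f (snd p)} \<in> sets (lborel \<Otimes>\<^sub>M lborel)"
      by (simp add: space_pair_measure cong: sets_pair_measure_cong)
    from lborel.measurable_emeasure_Pair[OF this] show ?thesis by (simp add: vimage_def)
  qed
  let ?G = "(p / (1 - t)) powr (1 - t) * (q / t) powr t"
  have "c * ?G * (a powr (1 - t) * b powr t)
     = W * (?G * ((a / U) powr (1 - t) * (b / V) powr t))"
    using a b U(1) V(1) by (simp add: W_def powr_divide field_simps)
  also have "\<dots> \<le> W * (p * (a / U) + q * (b / V))"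
    using W t p q a b U(1) V(1) by (intro mult_left_mono weighted_geometric_mean_le) auto
  finally have "ennreal (c * ?G * (a powr (1 - t) * b powr t))
     \<le> ennreal (W * (p * (a / U) + q * (b / V)))" by (rule ennreal_leI)
  also have "\<dots> = ennreal W * (ennreal p * ennreal (a / U) + ennreal q * ennreal (b / V))"
  proof -
    have *: "ennreal (W * (p * X + q * Y)) = ennreal W * (ennreal p * ennreal X + ennreal q * ennreal Y)"
      if "0 \<le> X" "0 \<le> Y" for X Y
      using W p q that by (simp add: ennreal_mult)
    show ?thesis by (rule *) (use a b U(1) V(1) in simp_all)
  qed
  also have "\<dots> \<le> ennreal W * (ennreal p * IU + ennreal q * IV)"
    using IU IV by (intro mult_left_mono add_mono) auto
  also have "ennreal p * IU + ennreal q * IV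
     = (\<integral>\<^sup>+r\<in>{0<..<1}. (ennreal p * emeasure lborel (?C r) + ennreal q * emeasure lborel (?D r)) \<partial>lborel)"
    unfolding IU_def IV_def using m
    by (simp add: nn_integral_cmult[symmetric] nn_integral_add[symmetric] distrib_right distrib_left mult_ac)
  also have "\<dots> \<le> (\<integral>\<^sup>+r\<in>{0<..<1}. emeasure lborel (?E r) \<partial>lborel)"
    using level by (intro nn_integral_mono) (auto simp: indicator_def)
  also have "ennreal W * \<dots> = (\<integral>\<^sup>+x. min (h x) (ennreal W) \<partial>lborel)"
    using W by (simp add: nn_integral_layer_cake)
  also have "\<dots> \<le> (\<integral>\<^sup>+x. h x \<partial>lborel)"
    by (intro nn_integral_mono) simp
  finally show "ennreal (c * ?G * (a powr (1 - t) * b powr t)) \<le> (\<integral>\<^sup>+x. h x \<partial>lborel)"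
    by (simp add: mult_left_mono)
qed

text \<open>
By Fubini: the one-dimensional inequality in coordinate \<open>i\<close> shows that the partial integrals over that
coordinate satisfy the hypothesis on the remaining coordinates, with one more factor in the constant.
\<close>

lemma prekopa_leindler_PiM:
  fixes u v h :: "('i \<Rightarrow> real) \<Rightarrow> ennreal"
  assumes "finite I"
    and t: "0 < t" "t < 1" and p: "p > 0" and q: "q > 0" and c: "c > 0"
    and "u \<in> borel_measurable (\<Pi>\<^sub>M i\<in>I. lborel)" "v \<in> borel_measurable (\<Pi>\<^sub>M i\<in>I. lborel)"
      "h \<in> borel_measurable (\<Pi>\<^sub>M i\<in>I. lborel)"
    and "\<And>x y. x \<in> space (\<Pi>\<^sub>M i\<in>I. lborel) \<Longrightarrow> y \<in> space (\<Pi>\<^sub>M i\<in>I. lborel) \<Longrightarrow>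
      geo_le c t (u x) (v y) (h (\<lambda>i\<in>I. p * x i + q * y i))"
  shows "geo_le (c * ((p / (1 - t)) powr (1 - t) * (q / t) powr t) ^ card I) t
    (\<integral>\<^sup>+x. u x \<partial>(\<Pi>\<^sub>M i\<in>I. lborel)) (\<integral>\<^sup>+x. v x \<partial>(\<Pi>\<^sub>M i\<in>I. lborel))
    (\<integral>\<^sup>+x. h x \<partial>(\<Pi>\<^sub>M i\<in>I. lborel))"
  using assms(1,6-)
proof (induction I arbitrary: u v h c rule: finite_induct)
  case empty
  interpret product_sigma_finite "\<lambda>_::'i. lborel :: real measure" by standard
  show ?case
    using empty.prems(5)[of "\<lambda>k. undefined" "\<lambda>k. undefined"]
    by (simp add: space_PiM restrict_def nn_integral_empty)
next
  case (insert i I)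
  interpret product_sigma_finite "\<lambda>_::'i. lborel :: real measure" by standard
  let ?P = "\<Pi>\<^sub>M i\<in>I. (lborel :: real measure)" and ?G = "(p / (1 - t)) powr (1 - t) * (q / t) powr t"
  have G: "?G > 0" using p q t by simp
  have meas: "(\<lambda>x. \<integral>\<^sup>+r. f (x(i := r)) \<partial>lborel) \<in> borel_measurable ?P"
    and meas1: "x \<in> space ?P \<Longrightarrow> (\<lambda>r. f (x(i := r))) \<in> borel_measurable borel"
    if f: "f \<in> borel_measurable (\<Pi>\<^sub>M i\<in>insert i I. lborel)" for f :: "('i \<Rightarrow> real) \<Rightarrow> ennreal" and x
  proof -
    have "(\<lambda>(x, r). f (x(i := r))) \<in> borel_measurable (?P \<Otimes>\<^sub>M lborel)"
      using measurable_comp[OF measurable_add_dim f] by (simp add: comp_def case_prod_beta)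
    then show "(\<lambda>x. \<integral>\<^sup>+r. f (x(i := r)) \<partial>lborel) \<in> borel_measurable ?P"
      by (rule lborel.borel_measurable_nn_integral)
    show "(\<lambda>r. f (x(i := r))) \<in> borel_measurable borel" if "x \<in> space ?P"
      using measurable_comp[OF measurable_component_update[OF that insert.hyps(2)] f]
      by (simp add: comp_def)
  qed
  have "geo_le (c * ?G * ?G ^ card I) t
     (\<integral>\<^sup>+x. \<integral>\<^sup>+r. u (x(i := r)) \<partial>lborel \<partial>?P) (\<integral>\<^sup>+x. \<integral>\<^sup>+r. v (x(i := r)) \<partial>lborel \<partial>?P)
     (\<integral>\<^sup>+x. \<integral>\<^sup>+r. h (x(i := r)) \<partial>lborel \<partial>?P)"
  proof (rule insert.IH)
    show "0 < c * ?G" using G insert.prems by simp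
    fix x y assume xy: "x \<in> space ?P" "y \<in> space ?P"
    let ?z = "\<lambda>i\<in>I. p * x i + q * y i"
    have z: "?z \<in> space ?P" by (auto simp: space_PiM)
    show "geo_le (c * ?G) t (\<integral>\<^sup>+r. u (x(i := r)) \<partial>lborel) (\<integral>\<^sup>+r. v (y(i := r)) \<partial>lborel)
       (\<integral>\<^sup>+r. h (?z(i := r)) \<partial>lborel)"
    proof (rule prekopa_leindler_real[OF _ _ _ t p q])
      fix r s
      have "x(i := r) \<in> space (\<Pi>\<^sub>M i\<in>insert i I. lborel)" "y(i := s) \<in> space (\<Pi>\<^sub>M i\<in>insert i I. lborel)"
        using xy by (auto simp: space_PiM PiE_def extensional_def)
      from insert.prems(5)[OF this]
      show "geo_le c t (u (x(i := r))) (v (y(i := s))) (h (?z(i := p * r + q * s)))"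
        by (rule back_subst[where P = "\<lambda>z. geo_le c t _ _ (h z)"])
           (use insert.hyps(2) in \<open>auto simp: fun_eq_iff\<close>)
    qed (rule meas1[OF insert.prems(2) xy(1)] meas1[OF insert.prems(3) xy(2)]
          meas1[OF insert.prems(4) z] insert.prems(1))+
  qed (rule meas insert.prems(2-4))+
  then show ?case
    using insert by (simp add: product_nn_integral_insert mult.assoc)
qed

lemma prekopa_leindler:
  fixes u v h :: "'a::euclidean_space \<Rightarrow> ennreal"
  assumes [measurable]: "u \<in> borel_measurable borel" "v \<in> borel_measurable borel" "h \<in> borel_measurable borel"
    and t: "0 < t" "t < 1" and p: "p > 0" and q: "q > 0"
    and uvh: "\<And>x y. geo_le 1 t (u x) (v y) (h (p *\<^sub>R x + q *\<^sub>R y))"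
  shows "geo_le (((p / (1 - t)) powr (1 - t) * (q / t) powr t) ^ DIM('a)) t
    (\<integral>\<^sup>+x. u x \<partial>lborel) (\<integral>\<^sup>+x. v x \<partial>lborel) (\<integral>\<^sup>+x. h x \<partial>lborel)"
proof -
  let ?e = "\<lambda>f :: 'a \<Rightarrow> real. \<Sum>b\<in>Basis. f b *\<^sub>R b"
  have e[measurable]: "?e \<in> borel_measurable (\<Pi>\<^sub>M b\<in>Basis. lborel)"
    by measurable
  have *: "(\<integral>\<^sup>+x. f x \<partial>lborel) = (\<integral>\<^sup>+x. f (?e x) \<partial>(\<Pi>\<^sub>M b\<in>Basis. lborel))"
    if "f \<in> borel_measurable borel" for f :: "'a \<Rightarrow> ennreal"
    using that by (subst lborel_eq) (simp add: nn_integral_distr)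
  have "geo_le (1 * ((p / (1 - t)) powr (1 - t) * (q / t) powr t) ^ card (Basis :: 'a set)) t
    (\<integral>\<^sup>+x. u (?e x) \<partial>(\<Pi>\<^sub>M b\<in>Basis. lborel)) (\<integral>\<^sup>+x. v (?e x) \<partial>(\<Pi>\<^sub>M b\<in>Basis. lborel))
    (\<integral>\<^sup>+x. h (?e x) \<partial>(\<Pi>\<^sub>M b\<in>Basis. lborel))"
  proof (rule prekopa_leindler_PiM[OF _ t p q])
    fix x y :: "'a \<Rightarrow> real"
    have "?e (\<lambda>i\<in>Basis. p * x i + q * y i) = p *\<^sub>R ?e x + q *\<^sub>R ?e y"
      by (simp add: scaleR_sum_right scaleR_add_left sum.distrib)
    then show "geo_le 1 t (u (?e x)) (v (?e y)) (h (?e (\<lambda>i\<in>Basis. p * x i + q * y i)))"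
      using uvh by simp
  qed auto
  then show ?thesis by (simp add: *)
qed

section \<open>Strong convexity from the Hessian bound\<close>

lemma has_derivative_grad:
  assumes "f differentiable (at x)"
  shows "(f has_derivative (\<lambda>h. grad f x \<bullet> h)) (at x)"
proof -
  let ?F = "frechet_derivative f (at x)"
  have d: "(f has_derivative ?F) (at x)" using assms frechet_derivative_works by blast
  then have lin: "linear ?F" by (rule has_derivative_linear)
  have "?F h = grad f x \<bullet> h" for h
  proof -
    have "?F h = ?F (\<Sum>i\<in>UNIV. h $ i *\<^sub>R axis i 1)"
      using basis_expansion[of h] by (simp add: scalar_mult_eq_scaleR)
    also have "\<dots> = (\<Sum>i\<in>UNIV. h $ i * ?F (axis i 1))"
      by (simp add: linear_sum[OF lin] linear_cmul[OF lin])
    also have "\<dots> = grad f x \<bullet> h"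
      by (simp add: grad_def inner_vec_def mult.commute)
    finally show ?thesis .
  qed
  then have "?F = (\<lambda>h. grad f x \<bullet> h)" by blast
  with d show ?thesis by simp
qed

lemma C2_borel_measurable:
  assumes "C2 f"
  shows "f \<in> borel_measurable borel"
proof (rule borel_measurable_continuous_onI)
  show "continuous_on UNIV f"
    using assms by (auto simp: C2_def intro!: differentiable_imp_continuous_on differentiable_at_imp_differentiable_on)
qed

context
  fixes V :: "real ^ 'n \<Rightarrow> real" and R :: real
  assumes C2: "C2 V" and Hess: "\<And>x. loewner_le (R *\<^sub>R mat 1) (Hess V x)"
begin

text \<open>
Along a line, subtracting the quadratic \<open>R/2 |w|\<^sup>2 r\<^sup>2\<close> turns the Hessian bound into nonnegativity of
an ordinary second derivative.
\<close>

lemma C2_line_derivs: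
  shows "((\<lambda>r. V (x + r *\<^sub>R w) - R / 2 * (norm w)\<^sup>2 * r\<^sup>2) has_real_derivative
      (grad V (x + r *\<^sub>R w) \<bullet> w - R * (norm w)\<^sup>2 * r)) (at r)" (is ?A)
    and "((\<lambda>r. grad V (x + r *\<^sub>R w) \<bullet> w - R * (norm w)\<^sup>2 * r) has_real_derivative
      (w \<bullet> ((Hess V (x + r *\<^sub>R w) - R *\<^sub>R mat 1) *v w))) (at r)" (is ?B)
proof -
  let ?p = "x + r *\<^sub>R w"
  have p: "((\<lambda>r. x + r *\<^sub>R w) has_derivative (\<lambda>h. h *\<^sub>R w)) (at r)"
    by (auto intro!: derivative_eq_intros)
  have "(V has_derivative (\<lambda>h. grad V ?p \<bullet> h)) (at ?p)"
    using C2 by (intro has_derivative_grad) (simp add: C2_def)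
  from diff_chain_at[OF p this]
  have "((\<lambda>r. V (x + r *\<^sub>R w)) has_real_derivative (grad V ?p \<bullet> w)) (at r)"
    by (simp add: has_field_derivative_def comp_def mult_commute_abs)
  then show ?A by (auto intro!: derivative_eq_intros)
  have "(grad V has_derivative (\<lambda>h. Hess V ?p *v h)) (at ?p)"
    using C2 unfolding C2_def Hess_def by (simp add: jacobian_works[symmetric])
  from has_derivative_inner_left[OF diff_chain_at[OF p this], of w]
  have "((\<lambda>r. grad V (x + r *\<^sub>R w) \<bullet> w) has_real_derivative (w \<bullet> (Hess V ?p *v w))) (at r)"
    by (simp add: has_field_derivative_def comp_def mult_commute_abs inner_commute
        matrix_vector_mult_scaleR)
  then have "((\<lambda>r. grad V (x + r *\<^sub>R w) \<bullet> w - R * (norm w)\<^sup>2 * r) has_real_derivative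
      (w \<bullet> (Hess V ?p *v w) - R * (norm w)\<^sup>2)) (at r)"
    by (auto intro!: derivative_eq_intros)
  also have "w \<bullet> (Hess V ?p *v w) - R * (norm w)\<^sup>2 = w \<bullet> ((Hess V ?p - R *\<^sub>R mat 1) *v w)"
    by (simp add: matrix_vector_mult_diff_rdistrib inner_diff_right power2_norm_eq_inner
        scaleR_matrix_vector_assoc[symmetric])
  finally show ?B .
qed

lemma Hess_ge_strongly_convex:
  assumes s: "0 \<le> s" "s \<le> 1"
  shows "V ((1 - s) *\<^sub>R x + s *\<^sub>R y) \<le> (1 - s) * V x + s * V y - R / 2 * (s * (1 - s)) * (norm (x - y))\<^sup>2"
proof -
  let ?w = "y - x"
  have "convex_on UNIV (\<lambda>r. V (x + r *\<^sub>R ?w) - R / 2 * (norm ?w)\<^sup>2 * r\<^sup>2)"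
    using Hess by (intro f''_ge0_imp_convex[OF _ C2_line_derivs]) (auto simp: loewner_le_def)
  from convex_onD[OF this, of s 0 1] s
  have "V (x + s *\<^sub>R ?w) - R / 2 * (norm ?w)\<^sup>2 * s\<^sup>2
     \<le> (1 - s) * V x + s * (V y - R / 2 * (norm ?w)\<^sup>2)" by simp
  moreover have "x + s *\<^sub>R ?w = (1 - s) *\<^sub>R x + s *\<^sub>R y" by (simp add: algebra_simps)
  ultimately show ?thesis
    by (simp add: norm_minus_commute algebra_simps power2_eq_square diff_divide_distrib)
qed

text \<open>
\<open>V\<close> lies above its tangent at the origin plus \<open>R/2 |x|\<^sup>2\<close>, and the quadratic term dominates.
\<close>

lemma Hess_ge_bounded_below:
  assumes R: "R > 0"
  obtains m where "\<And>x. m \<le> V x"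
proof
  fix x
  let ?g = "grad V 0"
  have "(?g \<bullet> x - R * (norm x)\<^sup>2 * 0) * (1 - 0)
     \<le> (V (0 + 1 *\<^sub>R x) - R / 2 * (norm x)\<^sup>2 * 1\<^sup>2) - (V (0 + 0 *\<^sub>R x) - R / 2 * (norm x)\<^sup>2 * 0\<^sup>2)"
    using f''_imp_f'[OF convex_UNIV C2_line_derivs[of 0 x], of 0 1] Hess
    by (simp add: loewner_le_def)
  then have 1: "?g \<bullet> x + R / 2 * (norm x)\<^sup>2 \<le> V x - V 0" by simp
  have "- (norm ?g * norm x) \<le> ?g \<bullet> x" using Cauchy_Schwarz_ineq2[of ?g x] by linarith
  moreover have "0 \<le> (R * norm x - norm ?g)\<^sup>2 / (2 * R)" using R by simp
  then have "norm ?g * norm x - (norm ?g)\<^sup>2 / (2 * R) \<le> R / 2 * (norm x)\<^sup>2"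
    using R by (simp add: field_simps power2_eq_square)
  ultimately show "V 0 - (norm ?g)\<^sup>2 / (2 * R) \<le> V x" using 1 by linarith
qed

end

section \<open>Integral estimates\<close>

lemma integral_le_nn_integral:
  fixes f g :: "'a \<Rightarrow> real"
  assumes f: "integrable M f" and le: "\<And>x. x \<in> space M \<Longrightarrow> f x \<le> g x" and g: "\<And>x. x \<in> space M \<Longrightarrow> 0 \<le> g x"
  shows "ennreal (\<integral>x. f x \<partial>M) \<le> (\<integral>\<^sup>+x. ennreal (g x) \<partial>M)"
proof -
  have i: "integrable M (\<lambda>x. max 0 (f x))" using f by (intro integrable_max) auto
  have "(\<integral>x. f x \<partial>M) \<le> (\<integral>x. max 0 (f x) \<partial>M)"
    using f i by (intro integral_mono) auto
  then have "ennreal (\<integral>x. f x \<partial>M) \<le> ennreal (\<integral>x. max 0 (f x) \<partial>M)" by (rule ennreal_leI)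
  also have "\<dots> = (\<integral>\<^sup>+x. ennreal (max 0 (f x)) \<partial>M)"
    using i by (intro nn_integral_eq_integral[symmetric]) auto
  also have "\<dots> \<le> (\<integral>\<^sup>+x. ennreal (g x) \<partial>M)"
    using le g by (intro nn_integral_mono ennreal_leI) auto
  finally show ?thesis .
qed

text \<open>
Jensen's inequality for the exponential, by integrating its tangent line at the mean value of \<open>W\<close>
on \<open>S\<close>. The right-hand side is an extended integral because it can be infinite.
\<close>

lemma jensen_exp_on_set:
  fixes W :: "'a \<Rightarrow> real"
  assumes "finite_measure M" and S: "S \<in> sets M" "measure M S > 0" and W: "integrable M W"
  shows "ennreal (measure M S * exp ((\<integral>x\<in>S. W x \<partial>M) / measure M S))
    \<le> (\<integral>\<^sup>+x\<in>S. ennreal (exp (W x)) \<partial>M)"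
proof -
  interpret finite_measure M by fact
  let ?m = "measure M S" and ?w = "(\<integral>x\<in>S. W x \<partial>M) / measure M S"
  have i: "integrable M (\<lambda>x. indicator S x * W x)"
    using integrable_mult_indicator[OF S(1) W] by simp
  have i1: "integrable M (\<lambda>x. indicator S x :: real)"
    using S(1) by (intro integrable_real_indicator) (auto simp: less_top[symmetric])
  have "(\<integral>x. exp ?w * ((1 - ?w) * indicator S x + indicator S x * W x) \<partial>M)
      = exp ?w * ((1 - ?w) * ?m + (\<integral>x\<in>S. W x \<partial>M))"
    using i i1 S by (simp add: set_lebesgue_integral_def)
  also have "\<dots> = ?m * exp ?w" using S by (simp add: field_simps)
  finally have *: "?m * exp ?w = (\<integral>x. exp ?w * ((1 - ?w) * indicator S x + indicator S x * W x) \<partial>M)" ..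
  have "ennreal (?m * exp ?w) \<le> (\<integral>\<^sup>+x. ennreal (exp (W x) * indicator S x) \<partial>M)"
    unfolding *
  proof (rule integral_le_nn_integral)
    fix x
    have "exp ?w * (1 + (W x - ?w)) \<le> exp ?w * exp (W x - ?w)"
      by (intro mult_left_mono exp_ge_add_one_self) simp
    then show "exp ?w * ((1 - ?w) * indicator S x + indicator S x * W x) \<le> exp (W x) * indicator S x"
      by (auto simp: indicator_def exp_diff algebra_simps)
  qed (use i i1 in auto)
  also have "(\<integral>\<^sup>+x. ennreal (exp (W x) * indicator S x) \<partial>M) = (\<integral>\<^sup>+x\<in>S. ennreal (exp (W x)) \<partial>M)"
    by (intro nn_integral_cong) (auto simp: indicator_def)
  finally show ?thesis .
qed

text \<open>
\<open>V e\<^sup>-\<^sup>V\<close> is bounded by a multiple of \<open>e\<^sup>-\<^sup>V\<^sup>/\<^sup>2\<close> where \<open>V\<close> is nonnegative. Convexity gives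
\<open>V(x)/2 \<ge> V(x/2) - V(0)/2\<close>, so \<open>e\<^sup>-\<^sup>V\<^sup>/\<^sup>2\<close> is bounded by a multiple of a dilate of the integrable
function \<open>e\<^sup>-\<^sup>V\<close>. Where \<open>V\<close> is negative, it is bounded by \<open>|m|\<close>.
\<close>

lemma convex_potential_integrable:
  fixes V :: "'a::euclidean_space \<Rightarrow> real"
  assumes [measurable]: "V \<in> borel_measurable borel"
    and conv: "\<And>x. V ((1/2) *\<^sub>R x) \<le> (V x + V 0) / 2"
    and bd: "\<And>x. m \<le> V x"
    and fin: "(\<integral>\<^sup>+x. ennreal (exp (- V x)) \<partial>lborel) < \<infinity>"
  shows "integrable (density lborel (\<lambda>x. ennreal (exp (- V x)))) V"
proof -
  have "(\<integral>\<^sup>+x. ennreal (exp (- V ((1/2) *\<^sub>R x))) \<partial>lborel)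
      = ennreal (2 ^ DIM('a)) * (\<integral>\<^sup>+x. ennreal (exp (- V x)) \<partial>lborel)"
    by (subst lborel_affine[where c = 2 and t = 0])
       (simp_all add: nn_integral_density nn_integral_distr nn_integral_cmult)
  also have "\<dots> < \<infinity>" using fin by (simp add: ennreal_mult_less_top)
  finally have i2: "integrable lborel (\<lambda>x. exp (- V ((1/2) *\<^sub>R x)))"
    by (intro integrableI_bounded) auto
  have i1: "integrable lborel (\<lambda>x. exp (- V x))"
    using fin by (intro integrableI_bounded) auto
  have "integrable lborel (\<lambda>x. exp (- V x) * V x)"
  proof (rule Bochner_Integration.integrable_bound)
    show "integrable lborel (\<lambda>x. 2 * exp (V 0 / 2) * exp (- V ((1/2) *\<^sub>R x)) + \<bar>m\<bar> * exp (- V x))"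
      using i1 i2 by simp
    show "AE x in lborel. norm (exp (- V x) * V x)
      \<le> norm (2 * exp (V 0 / 2) * exp (- V ((1/2) *\<^sub>R x)) + \<bar>m\<bar> * exp (- V x))"
    proof (rule AE_I2)
      fix x
      let ?b = "2 * exp (V 0 / 2) * exp (- V ((1/2) *\<^sub>R x)) + \<bar>m\<bar> * exp (- V x)"
      have "exp (- V x) * \<bar>V x\<bar> \<le> ?b"
      proof (cases "V x \<ge> 0")
        case True
        have "exp (- V x) * V x \<le> exp (- V x) * (2 * exp (V x / 2))"
          using exp_ge_add_one_self[of "V x / 2"] by (intro mult_left_mono) (linarith, simp)
        also have "\<dots> = 2 * exp (- V x / 2)" by (simp add: mult_exp_exp field_simps)
        also have "exp (- V x / 2) \<le> exp (V 0 / 2 + - V ((1/2) *\<^sub>R x))"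
          using conv[of x] by (simp add: field_simps)
        also have "\<dots> = exp (V 0 / 2) * exp (- V ((1/2) *\<^sub>R x))" by (rule exp_add)
        finally show ?thesis using True by (simp add: add_increasing2)
      next
        case False
        then have "\<bar>V x\<bar> \<le> \<bar>m\<bar>" using bd[of x] by linarith
        then have "exp (- V x) * \<bar>V x\<bar> \<le> \<bar>m\<bar> * exp (- V x)" by simp
        then show ?thesis by (simp add: add_increasing)
      qed
      then show "norm (exp (- V x) * V x) \<le> norm ?b" by (simp add: abs_mult)
    qed
  qed measurable
  then show ?thesis by (simp add: integrable_density)
qed

lemma exp_le_quadratic:
  fixes w :: real
  assumes "w \<le> 1"
  shows "exp w \<le> 1 + w + w\<^sup>2"
proof (cases "0 \<le> w")
  case True
  then show ?thesis using assms by (intro exp_bound) auto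
next
  case False
  have "w ^ 3 \<le> 0" using False by (simp add: power_le_zero_eq)
  then have "1 \<le> (1 + w + w\<^sup>2) * (1 - w)"
    by (simp add: algebra_simps power2_eq_square power3_eq_cube)
  also have "\<dots> \<le> (1 + w + w\<^sup>2) * exp (- w)"
  proof (rule mult_left_mono)
    show "1 - w \<le> exp (- w)" using exp_ge_add_one_self[of "- w"] by simp
    have "0 \<le> (1 + 2 * w)\<^sup>2 + 3" by (simp add: add_nonneg_nonneg)
    then show "0 \<le> 1 + w + w\<^sup>2" by (simp add: power2_eq_square algebra_simps)
  qed
  finally have "exp w * 1 \<le> exp w * ((1 + w + w\<^sup>2) * exp (- w))"
    by (intro mult_left_mono) auto
  also have "exp w * ((1 + w + w\<^sup>2) * exp (- w)) = 1 + w + w\<^sup>2"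
    by (simp add: exp_minus)
  finally show ?thesis by simp
qed

lemma nn_integral_exp_bounded_le:
  fixes f :: "'a \<Rightarrow> real"
  assumes "prob_space M" and [measurable]: "f \<in> borel_measurable M"
    and M: "\<And>x. \<bar>f x\<bar> \<le> B" and s: "0 < s" "s * B \<le> 1"
  shows "(\<integral>\<^sup>+x. ennreal (exp (s * f x)) \<partial>M) \<le> ennreal (exp (s * (\<integral>x. f x \<partial>M) + s\<^sup>2 * B\<^sup>2))"
proof -
  interpret prob_space M by fact
  have i: "integrable M f" using M by (intro integrable_const_bound[where B = B]) auto
  have "(\<integral>\<^sup>+x. ennreal (exp (s * f x)) \<partial>M) \<le> (\<integral>\<^sup>+x. ennreal (1 + s * f x + s\<^sup>2 * B\<^sup>2) \<partial>M)"
  proof (intro nn_integral_mono ennreal_leI)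
    fix x
    have "\<bar>s * f x\<bar> \<le> s * B" using M[of x] s by (simp add: abs_mult)
    then have "(s * f x)\<^sup>2 \<le> (s * B)\<^sup>2" and "s * f x \<le> 1"
      using s by (auto intro!: power2_le_iff_abs_le[THEN iffD2] order_trans[OF abs_ge_zero])
    with exp_le_quadratic[of "s * f x"] show "exp (s * f x) \<le> 1 + s * f x + s\<^sup>2 * B\<^sup>2" by (simp add: power_mult_distrib)
  qed
  also have "\<dots> = ennreal (\<integral>x. 1 + s * f x + s\<^sup>2 * B\<^sup>2 \<partial>M)"
  proof (rule nn_integral_eq_integral)
    have "0 \<le> 1 + s * f x + s\<^sup>2 * B\<^sup>2" for x
    proof -
      have "\<bar>s * f x\<bar> \<le> s * B" using M[of x] s by (simp add: abs_mult)
      then have "-1 \<le> s * f x" using s by linarith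
      then show ?thesis by (simp add: add_nonneg_nonneg)
    qed
    then show "AE x in M. 0 \<le> 1 + s * f x + s\<^sup>2 * B\<^sup>2" by simp
  qed (use i in auto)
  also have "(\<integral>x. 1 + s * f x + s\<^sup>2 * B\<^sup>2 \<partial>M) = 1 + (s * (\<integral>x. f x \<partial>M) + s\<^sup>2 * B\<^sup>2)"
    using i by (simp add: prob_space)
  also have "ennreal \<dots> \<le> ennreal (exp (s * (\<integral>x. f x \<partial>M) + s\<^sup>2 * B\<^sup>2))"
    by (intro ennreal_leI exp_ge_add_one_self)
  finally show ?thesis .
qed

section \<open>The dual dimensional transport inequality\<close>

text \<open>
Apply the rescaled Prekopa-Leindler inequality at \<open>z = (1 - s) x + s y\<close> with \<open>s = \<kappa> t\<close> but exponents
\<open>1 - t\<close> and \<open>t\<close>, to \<open>u = exp (- (1 - s)/(1 - t) V)\<close>, \<open>v = 1\<^sub>S exp (\<kappa> (q - V))\<close> and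
\<open>h = exp (- V + s f)\<close>. The pointwise hypothesis follows from strong convexity: the gain
\<open>R/2 s (1 - s) |x - y|\<^sup>2\<close> pays for the cost \<open>s R/2 |y - z|\<^sup>2\<close>, because \<open>|y - z| = (1 - s) |x - y|\<close>
and \<open>(1 - s)\<^sup>2 \<le> 1 - s\<close>.
Jensen's inequality bounds the integrals of \<open>u\<close> and \<open>v\<close> below, and \<open>h\<close> is expanded to second order in
\<open>s\<close>. Everything is then of order \<open>t\<close>, and the claim is the inequality divided by \<open>t\<close>.
\<close>

lemma dual_transport_inequality_approx:
  fixes V f :: "'a::euclidean_space \<Rightarrow> real" and R q \<kappa> t :: real
    and \<mu> :: "'a measure"
  assumes \<mu>_def: "\<mu> = density lborel (\<lambda>x. ennreal (exp (- V x)))"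
    and prob: "prob_space \<mu>"
    and Vm[measurable]: "V \<in> borel_measurable borel"
    and conv: "\<And>x y s. 0 \<le> s \<Longrightarrow> s \<le> 1 \<Longrightarrow> V ((1 - s) *\<^sub>R x + s *\<^sub>R y)
        \<le> (1 - s) * V x + s * V y - R / 2 * (s * (1 - s)) * (norm (x - y))\<^sup>2"
    and R: "R > 0" and Vi: "integrable \<mu> V"
    and fm[measurable]: "f \<in> borel_measurable borel" and fB: "\<And>x. \<bar>f x\<bar> \<le> B"
    and Sm[measurable]: "S \<in> sets borel" and Spos: "measure \<mu> S > 0"
    and q: "\<And>y z. y \<in> S \<Longrightarrow> q \<le> f z + R / 2 * (norm (y - z))\<^sup>2"
    and k: "\<kappa> > 0" and t: "0 < t" "t < 1" "\<kappa> * t < 1" "\<kappa> * t * B \<le> 1"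
  shows "DIM('a) * ((1 - \<kappa>) * (1 - t) / (1 - \<kappa> * t) + ln \<kappa>) + (\<kappa> - 1) * (\<integral>x. V x \<partial>\<mu>)
      + ln (measure \<mu> S) + \<kappa> * q + (1 - \<kappa>) * ((\<integral>x\<in>S. V x \<partial>\<mu>) / measure \<mu> S)
    \<le> \<kappa> * (\<integral>x. f x \<partial>\<mu>) + \<kappa>\<^sup>2 * t * B\<^sup>2"
proof -
  interpret prob_space \<mu> by fact
  have sets[measurable_cong, simp]: "sets \<mu> = sets borel" by (simp add: \<mu>_def)
  define s where "s = \<kappa> * t"
  have s: "0 < s" "s < 1" using k t by (auto simp: s_def)
  define u where "u x = ennreal (exp (- ((1 - s) / (1 - t)) * V x))" for x
  define v where "v y = ennreal (exp (\<kappa> * (q - V y))) * indicator S y" for y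
  define h where "h z = ennreal (exp (- V z + s * f z))" for z
  have [measurable]: "u \<in> borel_measurable borel" "v \<in> borel_measurable borel" "h \<in> borel_measurable borel"
    unfolding u_def v_def h_def by measurable
  have dens: "(\<integral>\<^sup>+x. g x \<partial>\<mu>) = (\<integral>\<^sup>+x. ennreal (exp (- V x)) * g x \<partial>lborel)"
    if "g \<in> borel_measurable borel" for g
    using that unfolding \<mu>_def by (subst nn_integral_density) auto
  define K where "K = ((1 - s) / (1 - t)) powr (1 - t) * (s / t) powr t"
  have K: "K > 0" using s t by (simp add: K_def)
  have PL: "geo_le (K ^ DIM('a)) t (\<integral>\<^sup>+x. u x \<partial>lborel) (\<integral>\<^sup>+x. v x \<partial>lborel) (\<integral>\<^sup>+x. h x \<partial>lborel)"
    unfolding K_def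
  proof (rule prekopa_leindler)
    fix x y :: 'a
    let ?z = "(1 - s) *\<^sub>R x + s *\<^sub>R y"
    show "geo_le 1 t (u x) (v y) (h ?z)"
      unfolding geo_le_def
    proof (intro allI impI)
      fix a b assume a: "0 < a" "ennreal a < u x" and b: "0 < b" "ennreal b < v y"
      have yS: "y \<in> S" using b(2) by (cases "y \<in> S") (simp_all add: v_def)
      have a': "a \<le> exp (- ((1 - s) / (1 - t)) * V x)"
        using a by (simp add: u_def ennreal_less_iff)
      have b': "b \<le> exp (\<kappa> * (q - V y))" using b yS by (simp add: v_def ennreal_less_iff)
      have "a powr (1 - t) * b powr t
         \<le> exp (- ((1 - s) / (1 - t)) * V x) powr (1 - t) * exp (\<kappa> * (q - V y)) powr t"
        using a b a' b' t by (intro mult_mono powr_mono2) auto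
      also have "\<dots> = exp (- (1 - s) * V x + s * (q - V y))"
        using t by (simp add: powr_def exp_add[symmetric] s_def field_simps)
      also have "\<dots> \<le> exp (- V ?z + s * f ?z)"
      proof -
        have "y - ?z = (1 - s) *\<^sub>R (y - x)" by (simp add: algebra_simps)
        then have "norm (y - ?z) = (1 - s) * norm (x - y)" using s by (simp add: norm_minus_commute)
        then have "q \<le> f ?z + R / 2 * ((1 - s) * norm (x - y))\<^sup>2" using q[OF yS, of ?z] by simp
        also have "R / 2 * ((1 - s) * norm (x - y))\<^sup>2 = R / 2 * (1 - s)\<^sup>2 * (norm (x - y))\<^sup>2"
          by (simp add: power_mult_distrib)
        also have "\<dots> \<le> R / 2 * (1 - s) * (norm (x - y))\<^sup>2"
          using R s by (intro mult_right_mono mult_left_mono) (auto simp: power2_eq_square mult_left_le)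
        finally have "s * q \<le> s * (f ?z + R / 2 * (1 - s) * (norm (x - y))\<^sup>2)"
          using s by (intro mult_left_mono) auto
        moreover have "V ?z \<le> (1 - s) * V x + s * V y - R / 2 * (s * (1 - s)) * (norm (x - y))\<^sup>2"
          using s by (intro conv) auto
        ultimately show ?thesis by (simp add: algebra_simps)
      qed
      finally show "ennreal (1 * (a powr (1 - t) * b powr t)) \<le> h ?z"
        by (simp add: h_def ennreal_leI)
    qed
  qed (use s t in auto)
  let ?c = "\<integral>x. V x \<partial>\<mu>" and ?m = "measure \<mu> S"
  define VS where "VS = (\<integral>x\<in>S. V x \<partial>\<mu>) / ?m"
  have u: "ennreal (exp ((s - t) / (1 - t) * ?c)) \<le> (\<integral>\<^sup>+x. u x \<partial>lborel)"
  proof -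
    have "space \<mu> = UNIV" by (simp add: \<mu>_def)
    then have "ennreal (exp ((s - t) / (1 - t) * ?c)) \<le> (\<integral>\<^sup>+x. ennreal (exp ((s - t) / (1 - t) * V x)) \<partial>\<mu>)"
      using jensen_exp_on_set[of \<mu> UNIV "\<lambda>x. (s - t) / (1 - t) * V x"] Vi prob_space
      by (simp add: finite_measure_axioms set_lebesgue_integral_def)
    also have "\<dots> = (\<integral>\<^sup>+x. ennreal (exp (- V x)) * ennreal (exp ((s - t) / (1 - t) * V x)) \<partial>lborel)"
      by (rule dens) measurable
    also have "\<dots> = (\<integral>\<^sup>+x. u x \<partial>lborel)"
      using t by (intro nn_integral_cong)
        (simp add: u_def ennreal_mult[symmetric] exp_add[symmetric] field_simps)
    finally show ?thesis .
  qed
  have v: "ennreal (?m * exp (\<kappa> * q + (1 - \<kappa>) * VS)) \<le> (\<integral>\<^sup>+x. v x \<partial>lborel)"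
  proof -
    have i: "integrable \<mu> (\<lambda>x. indicator S x * V x)"
      using integrable_mult_indicator[of S \<mu> V] Vi by simp
    have i1: "integrable \<mu> (\<lambda>x. indicator S x :: real)"
      by (intro integrable_real_indicator) (auto simp: less_top[symmetric])
    have "(\<integral>x\<in>S. (\<kappa> * q + (1 - \<kappa>) * V x) \<partial>\<mu>)
       = (\<integral>x. \<kappa> * q * indicator S x + (1 - \<kappa>) * (indicator S x * V x) \<partial>\<mu>)"
      unfolding set_lebesgue_integral_def by (intro Bochner_Integration.integral_cong) (auto simp: algebra_simps)
    also have "\<dots> = \<kappa> * q * ?m + (1 - \<kappa>) * (\<integral>x\<in>S. V x \<partial>\<mu>)"
      using i i1 by (simp add: set_lebesgue_integral_def)
    finally have "(\<integral>x\<in>S. (\<kappa> * q + (1 - \<kappa>) * V x) \<partial>\<mu>) / ?m = \<kappa> * q + (1 - \<kappa>) * VS"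
      using Spos by (simp add: VS_def field_simps)
    then have "ennreal (?m * exp (\<kappa> * q + (1 - \<kappa>) * VS))
        \<le> (\<integral>\<^sup>+x\<in>S. ennreal (exp (\<kappa> * q + (1 - \<kappa>) * V x)) \<partial>\<mu>)"
      using jensen_exp_on_set[of \<mu> S "\<lambda>x. \<kappa> * q + (1 - \<kappa>) * V x"] Vi Spos
      by (simp add: finite_measure_axioms)
    also have "\<dots> = (\<integral>\<^sup>+x. ennreal (exp (- V x)) * (ennreal (exp (\<kappa> * q + (1 - \<kappa>) * V x)) * indicator S x) \<partial>lborel)"
      by (rule dens) measurable
    also have "\<dots> = (\<integral>\<^sup>+x. v x \<partial>lborel)"
      by (intro nn_integral_cong)
        (simp add: v_def mult.assoc[symmetric] ennreal_mult[symmetric] exp_add[symmetric] algebra_simps)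
    finally show ?thesis .
  qed
  have h: "(\<integral>\<^sup>+x. h x \<partial>lborel) \<le> ennreal (exp (s * (\<integral>x. f x \<partial>\<mu>) + s\<^sup>2 * B\<^sup>2))"
  proof -
    have "(\<integral>\<^sup>+x. h x \<partial>lborel) = (\<integral>\<^sup>+x. ennreal (exp (- V x)) * ennreal (exp (s * f x)) \<partial>lborel)"
      by (intro nn_integral_cong) (simp add: h_def ennreal_mult[symmetric] exp_add[symmetric])
    also have "\<dots> = (\<integral>\<^sup>+x. ennreal (exp (s * f x)) \<partial>\<mu>)"
      by (rule dens[symmetric]) measurable
    also have "\<dots> \<le> ennreal (exp (s * (\<integral>x. f x \<partial>\<mu>) + s\<^sup>2 * B\<^sup>2))"
      using fB s t by (intro nn_integral_exp_bounded_le[OF prob]) (auto simp: s_def)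
    finally show ?thesis .
  qed
  let ?a = "exp ((s - t) / (1 - t) * ?c)" and ?b = "?m * exp (\<kappa> * q + (1 - \<kappa>) * VS)"
  have "ennreal (K ^ DIM('a) * (?a powr (1 - t) * ?b powr t)) \<le> (\<integral>\<^sup>+x. h x \<partial>lborel)"
    using u v Spos by (intro geo_le_imp_le[OF PL]) auto
  also note h
  finally have "K ^ DIM('a) * (?a powr (1 - t) * ?b powr t) \<le> exp (s * (\<integral>x. f x \<partial>\<mu>) + s\<^sup>2 * B\<^sup>2)"
    by (simp add: ennreal_le_iff)
  then have "ln (K ^ DIM('a) * (?a powr (1 - t) * ?b powr t)) \<le> ln (exp (s * (\<integral>x. f x \<partial>\<mu>) + s\<^sup>2 * B\<^sup>2))"
    using K Spos by (subst ln_le_cancel_iff) auto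
  then have "ln (K ^ DIM('a) * (?a powr (1 - t) * ?b powr t)) \<le> s * (\<integral>x. f x \<partial>\<mu>) + s\<^sup>2 * B\<^sup>2"
    by simp
  moreover have "ln (K ^ DIM('a) * (?a powr (1 - t) * ?b powr t))
     = DIM('a) * ln K + ((s - t) * ?c + t * (ln ?m + \<kappa> * q + (1 - \<kappa>) * VS))"
    using K Spos t by (simp add: ln_mult ln_powr ln_realpow)
  moreover have "ln K \<ge> t * ((1 - \<kappa>) * (1 - t) / (1 - \<kappa> * t) + ln \<kappa>)"
  proof -
    have "1 - (1 - t) / (1 - s) \<le> ln ((1 - s) / (1 - t))"
      using ln_le_minus_one[of "(1 - t) / (1 - s)"] s t by (simp add: ln_div)
    then have "(1 - t) * (1 - (1 - t) / (1 - s)) \<le> (1 - t) * ln ((1 - s) / (1 - t))"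
      using t by (intro mult_left_mono) auto
    moreover have "(1 - t) * (1 - (1 - t) / (1 - s)) = t * ((1 - \<kappa>) * (1 - t) / (1 - \<kappa> * t))"
      using s t by (simp add: s_def field_simps)
    moreover have "ln K = (1 - t) * ln ((1 - s) / (1 - t)) + t * ln \<kappa>"
      using s t k by (simp add: K_def ln_mult ln_powr s_def)
    ultimately show ?thesis by (simp add: distrib_left)
  qed
  then have "DIM('a) * (t * ((1 - \<kappa>) * (1 - t) / (1 - \<kappa> * t) + ln \<kappa>)) \<le> DIM('a) * ln K"
    by (intro mult_left_mono) auto
  ultimately have "DIM('a) * (t * ((1 - \<kappa>) * (1 - t) / (1 - \<kappa> * t) + ln \<kappa>))
     + ((s - t) * ?c + t * (ln ?m + \<kappa> * q + (1 - \<kappa>) * VS)) \<le> s * (\<integral>x. f x \<partial>\<mu>) + s\<^sup>2 * B\<^sup>2"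
    by linarith
  then have "t * (DIM('a) * ((1 - \<kappa>) * (1 - t) / (1 - \<kappa> * t) + ln \<kappa>) + (\<kappa> - 1) * ?c
      + ln ?m + \<kappa> * q + (1 - \<kappa>) * VS) \<le> t * (\<kappa> * (\<integral>x. f x \<partial>\<mu>) + \<kappa>\<^sup>2 * t * B\<^sup>2)"
    unfolding s_def power2_eq_square by (simp only: algebra_simps)
  then show ?thesis using t unfolding VS_def by (simp only: mult_le_cancel_left_pos)
qed

text \<open>
This is the limit \<open>t \<rightarrow> 0\<close>. For \<open>\<kappa> = 1\<close> it reads \<open>ln \<mu>(S) \<le> \<integral> f d\<mu> - q\<close>, a dual form of Talagrand's
transport inequality for \<open>\<mu>\<close> conditioned on \<open>S\<close>. The other values of \<open>\<kappa>\<close> bring in the dimension: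
\<open>\<kappa>\<close> is the slope of the tangent replacing the logarithm on the right of the arithmetic-geometric inequality
\<open>ln det \<le> n ln (tr / n)\<close> for the derivative of a transport map.
\<close>

lemma dual_transport_inequality:
  fixes V f :: "'a::euclidean_space \<Rightarrow> real" and R q \<kappa> :: real
    and \<mu> :: "'a measure"
  assumes \<mu>_def: "\<mu> = density lborel (\<lambda>x. ennreal (exp (- V x)))"
    and prob: "prob_space \<mu>"
    and Vm: "V \<in> borel_measurable borel"
    and conv: "\<And>x y s. 0 \<le> s \<Longrightarrow> s \<le> 1 \<Longrightarrow> V ((1 - s) *\<^sub>R x + s *\<^sub>R y)
        \<le> (1 - s) * V x + s * V y - R / 2 * (s * (1 - s)) * (norm (x - y))\<^sup>2"
    and R: "R > 0" and Vi: "integrable \<mu> V"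
    and fm: "f \<in> borel_measurable borel" and fB: "\<And>x. \<bar>f x\<bar> \<le> B"
    and Sm: "S \<in> sets borel" and Spos: "measure \<mu> S > 0"
    and q: "\<And>y z. y \<in> S \<Longrightarrow> q \<le> f z + R / 2 * (norm (y - z))\<^sup>2"
    and k: "\<kappa> > 0"
  shows "ln (measure \<mu> S) + (1 - \<kappa>) * ((\<integral>x\<in>S. V x \<partial>\<mu>) / measure \<mu> S - (\<integral>x. V x \<partial>\<mu>))
    \<le> \<kappa> * ((\<integral>x. f x \<partial>\<mu>) - q) + DIM('a) * (\<kappa> - 1 - ln \<kappa>)"
proof -
  let ?l = "\<lambda>t. DIM('a) * ((1 - \<kappa>) * (1 - t) / (1 - \<kappa> * t) + ln \<kappa>) + (\<kappa> - 1) * (\<integral>x. V x \<partial>\<mu>)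
      + ln (measure \<mu> S) + \<kappa> * q + (1 - \<kappa>) * ((\<integral>x\<in>S. V x \<partial>\<mu>) / measure \<mu> S)"
  let ?r = "\<lambda>t. \<kappa> * (\<integral>x. f x \<partial>\<mu>) + \<kappa>\<^sup>2 * t * B\<^sup>2"
  have "?l 0 \<le> ?r 0"
  proof (rule tendsto_le)
    show "(?l \<longlongrightarrow> ?l 0) (at_right 0)" by (intro tendsto_intros) auto
    show "(?r \<longlongrightarrow> ?r 0) (at_right 0)" by (intro tendsto_intros)
    have "((\<lambda>t. \<kappa> * t) \<longlongrightarrow> \<kappa> * 0) (at_right 0)" "((\<lambda>t. \<kappa> * t * B) \<longlongrightarrow> \<kappa> * 0 * B) (at_right 0)"
      by (intro tendsto_intros)+
    then have "\<forall>\<^sub>F t in at_right 0. \<kappa> * t < 1" "\<forall>\<^sub>F t in at_right 0. \<kappa> * t * B < 1"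
      by (auto elim!: order_tendstoD)
    moreover have "\<forall>\<^sub>F t in at_right 0. t < (1::real)"
      by (rule order_tendstoD(2)[OF tendsto_ident_at]) simp
    moreover have "\<forall>\<^sub>F t in at_right (0::real). 0 < t" by (simp add: eventually_at_right_less)
    ultimately show "\<forall>\<^sub>F t in at_right 0. ?l t \<le> ?r t"
    proof eventually_elim
      case (elim t)
      show ?case
        by (rule dual_transport_inequality_approx[OF \<mu>_def prob Vm conv R Vi fm fB Sm Spos q k])
          (use elim in auto)
    qed
  qed simp
  then show ?thesis by (simp add: algebra_simps)
qed

section \<open>Mass of the far set\<close>

text \<open>
Sets outside the sigma-algebra have measure \<open>0\<close>, so positive measure alone makes \<open>A\<close> measurable for the
completion. This is how the far set gets its measurability.
\<close>

lemma completion_inner_representative: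
  assumes "measure (completion M) A > 0"
  obtains A' where "A' \<in> sets M" "A' \<subseteq> A" "measure M A' = measure (completion M) A"
    "A \<in> sets (completion M)" "AE x in M. x \<in> A \<longleftrightarrow> x \<in> A'"
proof
  show A: "A \<in> sets (completion M)" using assms measure_notin_sets[of A "completion M"] by force
  show "main_part M A \<in> sets M" using A by simp
  show "main_part M A \<subseteq> A" using main_part_null_part_Un[OF A] by blast
  show "measure M (main_part M A) = measure (completion M) A"
    using A by (simp add: measure_def)
  show "AE x in M. x \<in> A \<longleftrightarrow> x \<in> main_part M A"
    using AE_notin_null_part[OF A] main_part_null_part_Un[OF A] by (auto elim!: eventually_mono)
qed

lemma integral_uniform_measure_completion:
  fixes f :: "'a \<Rightarrow> real"
  assumes f: "f \<in> borel_measurable M" and "finite_measure M"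
    and B: "B \<in> sets (completion M)" "measure (completion M) B > 0"
    and B': "B' \<in> sets M" "AE x in M. x \<in> B \<longleftrightarrow> x \<in> B'"
  shows "(\<integral>x. f x \<partial>(uniform_measure (completion M) B)) = (\<integral>x\<in>B'. f x \<partial>M) / measure (completion M) B"
proof -
  interpret finite_measure M by fact
  let ?b = "measure (completion M) B"
  have fin: "emeasure (completion M) B = ennreal ?b"
    using B(1) by (intro emeasure_eq_ennreal_measure) simp
  have "uniform_measure (completion M) B = density (completion M) (\<lambda>x. ennreal (indicator B x / ?b))"
    unfolding uniform_measure_def using B(2)
    by (intro arg_cong[where f = "density _"] ext)
       (simp add: fin divide_ennreal ennreal_indicator[symmetric] del: ennreal_indicator)
  then have "(\<integral>x. f x \<partial>(uniform_measure (completion M) B))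
      = (\<integral>x. indicator B x / ?b * f x \<partial>(completion M))"
    using B f measurable_completion[OF f] by (simp add: integral_density)
  also have "\<dots> = (\<integral>x. indicator B' x / ?b * f x \<partial>(completion M))"
  proof (rule integral_cong_AE)
    have [measurable]: "B \<in> sets (completion M)" "B' \<in> sets (completion M)"
      "f \<in> borel_measurable (completion M)"
      using B B' f by (auto intro: measurable_completion)
    show "(\<lambda>x. indicator B x / ?b * f x) \<in> borel_measurable (completion M)"
      "(\<lambda>x. indicator B' x / ?b * f x) \<in> borel_measurable (completion M)"
      by measurable
    show "AE x in completion M. indicator B x / ?b * f x = indicator B' x / ?b * f x"
      using AE_completion[OF B'(2)] by eventually_elim (simp add: indicator_def)
  qed
  also have "\<dots> = (\<integral>x. indicator B' x / ?b * f x \<partial>M)"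
    using B' f by (intro integral_completion) auto
  also have "\<dots> = (\<integral>x. indicator B' x * f x / ?b \<partial>M)" by simp
  also have "\<dots> = (\<integral>x\<in>B'. f x \<partial>M) / ?b"
    unfolding set_lebesgue_integral_def by simp
  finally show ?thesis .
qed

text \<open>
The infimal convolution of \<open>\<theta> d\<^sup>2\<close> and \<open>e\<^sup>2\<close> under the constraint \<open>d + e \<ge> r\<close>. It replaces the triangle
inequality for the Wasserstein distance.
\<close>

lemma weighted_square_triangle:
  fixes \<theta> d e r :: real
  assumes "\<theta> > 0" "0 \<le> r" "r \<le> d + e"
  shows "\<theta> / (1 + \<theta>) * r\<^sup>2 \<le> \<theta> * d\<^sup>2 + e\<^sup>2"
proof -
  have "r\<^sup>2 \<le> (d + e)\<^sup>2" using assms by (intro power_mono) auto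
  then have "\<theta> * r\<^sup>2 \<le> \<theta> * (d + e)\<^sup>2" using assms by simp
  also have "\<dots> = (1 + \<theta>) * (\<theta> * d\<^sup>2 + e\<^sup>2) - (\<theta> * d - e)\<^sup>2"
    by (simp add: power2_eq_square algebra_simps)
  also have "\<dots> \<le> (1 + \<theta>) * (\<theta> * d\<^sup>2 + e\<^sup>2)" by simp
  finally show ?thesis using assms by (simp add: divide_le_eq mult.commute)
qed

text \<open>
The right-hand side of the hypothesis is minimal at \<open>\<kappa> = 1/X\<close>, with value \<open>n ln X\<close>. For
\<open>X \<le> 0\<close> it would be unbounded below, so the hypothesis forces \<open>X > 0\<close>.
\<close>

lemma le_power_if_le_scaled_log:
  fixes X l :: real and n :: nat
  assumes n: "n > 0" and le: "\<And>\<kappa>. \<kappa> > 0 \<Longrightarrow> l \<le> n * (\<kappa> * X - 1 - ln \<kappa>)"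
  shows "exp l \<le> X ^ n"
proof -
  have X: "X > 0"
  proof (rule ccontr)
    assume "\<not> X > 0"
    \<comment> \<open>\<open>\<kappa> = exp (- l / n)\<close> gives \<open>n * ln \<kappa> = - l\<close>, so that \<open>l\<close> cancels.\<close>
    then have "exp (- l / n) * X \<le> 0" by (simp add: mult_nonneg_nonpos)
    moreover have "l \<le> n * (exp (- l / n) * X) - n + l"
      using le[of "exp (- l / n)"] n by (simp add: algebra_simps)
    ultimately show False using n by (smt (verit) mult_nonneg_nonpos of_nat_0_less_iff)
  qed
  have "l \<le> n * ln X" using le[of "1 / X"] X by (simp add: ln_div)
  then have "exp l \<le> exp (n * ln X)" by simp
  also have "\<dots> = X ^ n" using X by (simp add: exp_of_nat_mult)
  finally show ?thesis .
qed

theorem corollary2p4: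
  fixes \<mu> :: "(real ^ 'n) measure"
    and V :: "real ^ 'n \<Rightarrow> real"
    and R r c_A c_V V_r :: real
    and A A_r :: "(real ^ 'n) set"
  assumes mu_P2: "\<mu> \<in> P2"
    and mu_density: "\<mu> = density lborel (\<lambda>x. ennreal (exp (- V x)))"
    and V_C2: "C2 V"
    and R_pos: "R > 0"
    and V_Hess: "\<And>x. loewner_le (R *\<^sub>R mat 1) (Hess V x)"
    and A_meas: "A \<in> sets lebesgue"
    and A_pos: "measure (completion \<mu>) A > 0"
    and r_pos: "r > 0"
    and A_r_def: "A_r = far_set A r"
    and A_r_pos: "measure (completion \<mu>) A_r > 0"
    and c_A_def: "c_A = sqrt (2 * inverse R * ln (1 / measure (completion \<mu>) A))"
    and c_V_def: "c_V = (\<integral>x. V x \<partial>\<mu>)"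
    and V_r_def: "V_r = (\<integral>x. V x \<partial>(uniform_measure (completion \<mu>) A_r))"
    and r_gt: "r > c_A"
  shows "measure (completion \<mu>) A_r
    \<le> exp (c_V - V_r) *
      (1 + 1 / real CARD('n) * (V_r - c_V - R / 2 * (r - c_A)\<^sup>2)) ^ CARD('n)"
proof -
  have muR: "prob_space \<mu>" using mu_P2 by (simp add: P2_def)
  interpret prob_space \<mu> by fact
  have sets[simp, measurable_cong]: "sets \<mu> = sets borel" by (simp add: mu_density)
  note Vm[measurable] = C2_borel_measurable[OF V_C2]
  have conv: "V ((1 - s) *\<^sub>R x + s *\<^sub>R y)
      \<le> (1 - s) * V x + s * V y - R / 2 * (s * (1 - s)) * (norm (x - y))\<^sup>2"
    if "0 \<le> s" "s \<le> 1" for x y s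
    using Hess_ge_strongly_convex[OF V_C2 V_Hess that] .
  obtain m where m: "\<And>x. m \<le> V x"
    using Hess_ge_bounded_below[OF V_C2 V_Hess R_pos] by metis
  have Vi: "integrable \<mu> V"
    unfolding mu_density
  proof (rule convex_potential_integrable[OF Vm _ m])
    show "V ((1/2) *\<^sub>R x) \<le> (V x + V 0) / 2" for x
    proof -
      have "0 \<le> R / 2 * (1 / 2 * (1 - 1 / 2)) * (norm (0 - x))\<^sup>2" using R_pos by simp
      with conv[of "1/2" 0 x] show ?thesis by simp
    qed
    have "(\<lambda>x. ennreal (exp (- V x))) \<in> borel_measurable lborel" by measurable
    from emeasure_density[OF this, of UNIV]
    have "(\<integral>\<^sup>+x. ennreal (exp (- V x)) \<partial>lborel) = emeasure \<mu> (space \<mu>)"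
      by (simp add: mu_density)
    then show "(\<integral>\<^sup>+x. ennreal (exp (- V x)) \<partial>lborel) < \<infinity>" by (simp add: emeasure_space_1)
  qed
  obtain A' where A': "A' \<in> sets \<mu>" "A' \<subseteq> A" "measure \<mu> A' = measure (completion \<mu>) A"
    using completion_inner_representative[OF A_pos] by metis
  obtain B where B: "B \<in> sets \<mu>" "B \<subseteq> A_r" "measure \<mu> B = measure (completion \<mu>) A_r"
    "A_r \<in> sets (completion \<mu>)" "AE x in \<mu>. x \<in> A_r \<longleftrightarrow> x \<in> B"
    using completion_inner_representative[OF A_r_pos] by metis
  define \<alpha> where "\<alpha> = measure \<mu> A'"
  define \<beta> where "\<beta> = measure \<mu> B"
  have \<alpha>: "\<alpha> > 0" and \<beta>: "\<beta> > 0" using A' B A_pos A_r_pos by (auto simp: \<alpha>_def \<beta>_def)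
  have V_r: "V_r = (\<integral>x\<in>B. V x \<partial>\<mu>) / \<beta>"
    unfolding V_r_def \<beta>_def B(3)
    by (rule integral_uniform_measure_completion) (use B A_r_pos finite_measure_axioms in auto)
  have far: "norm (a - y) > r" if "a \<in> A" "y \<in> B" for a y
    using that B(2) by (auto simp: A_r_def far_set_def)
  \<comment> \<open>Disjointness gives \<open>\<mu>(A) < 1\<close>, hence \<open>c_A > 0\<close>, so that \<open>\<theta>\<close> below makes sense.\<close>
  have "A' \<inter> B = {}" using A'(2) far r_pos by fastforce
  then have "\<alpha> + \<beta> = measure \<mu> (A' \<union> B)"
    using A' B by (simp add: \<alpha>_def \<beta>_def finite_measure_Union)
  then have "\<alpha> < 1" using \<beta> prob_le_1[of "A' \<union> B"] by linarith
  define L where "L = ln (1 / \<alpha>)"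
  have L: "L > 0" using \<alpha> \<open>\<alpha> < 1\<close> by (simp add: L_def)
  have c: "c_A = sqrt (2 * inverse R * L)" using A' by (simp add: c_A_def L_def \<alpha>_def)
  then have c_pos: "c_A > 0" using L R_pos by simp
  have cL: "R / 2 * c_A\<^sup>2 = L" using c L R_pos by (simp add: field_simps)
  \<comment> \<open>\<open>1 + \<theta> = r / c_A\<close> maximises \<open>\<theta> / (1 + \<theta>) * r\<^sup>2 - \<theta> * c_A\<^sup>2\<close>, with maximum \<open>(r - c_A)\<^sup>2\<close>.\<close>
  define \<theta> where "\<theta> = r / c_A - 1"
  have \<theta>: "\<theta> > 0" using r_gt c_pos by (simp add: \<theta>_def)
  \<comment> \<open>The cap keeps the test function bounded. It is chosen so that \<open>\<theta> * M\<close> is the bound \<open>R / 2 * (\<theta> / (1 + \<theta>) * r\<^sup>2)\<close>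
    which the uncapped function would give.\<close>
  define M where "M = R / 2 * (r * c_A)"
  have M: "M > 0" using R_pos r_pos c_pos by (simp add: M_def)
  define \<phi> where "\<phi> x = min (R / 2 * (infdist x A)\<^sup>2) M" for x
  have "A \<noteq> {}" using A_pos by auto
  have [measurable]: "\<phi> \<in> borel_measurable borel"
    unfolding \<phi>_def by (intro borel_measurable_continuous_onI continuous_intros)
  have \<phi>: "0 \<le> \<phi> x" "\<phi> x \<le> M" for x using R_pos M by (auto simp: \<phi>_def)
  \<comment> \<open>Talagrand's inequality for \<open>\<mu>\<close> conditioned on \<open>A\<close>, tested on the capped squared distance to \<open>A\<close>.\<close>
  have \<phi>L: "(\<integral>x. \<phi> x \<partial>\<mu>) \<le> L"
  proof -
    have "0 \<le> - \<phi> z + R / 2 * (norm (y - z))\<^sup>2" if "y \<in> A'" for y z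
    proof -
      have "infdist z A \<le> norm (y - z)"
        using infdist_le[of y A z] A'(2) that by (auto simp: dist_norm norm_minus_commute)
      then have "R / 2 * (infdist z A)\<^sup>2 \<le> R / 2 * (norm (y - z))\<^sup>2"
        using R_pos by (intro mult_left_mono power_mono infdist_nonneg) auto
      then show ?thesis by (simp add: \<phi>_def)
    qed
    then have "ln \<alpha> \<le> (\<integral>x. - \<phi> x \<partial>\<mu>)"
      using dual_transport_inequality[where \<kappa> = 1 and f = "\<lambda>x. - \<phi> x" and B = M and S = A' and q = 0,
          OF mu_density muR Vm conv R_pos Vi] \<phi> A' \<alpha>
      by (simp add: \<alpha>_def)
    then show ?thesis using \<alpha> by (simp add: L_def ln_div)
  qed
  define D where "D = V_r - c_V"
  define W where "W = R / 2 * (r - c_A)\<^sup>2"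
  have W: "\<theta> * M - \<theta> * L = W"
    using c_pos by (simp add: \<theta>_def M_def W_def cL[symmetric] power2_eq_square field_simps)
  let ?n = "real CARD('n)" and ?X = "1 + 1 / real CARD('n) * (D - W)"
  have "exp (ln \<beta> + D) \<le> ?X ^ CARD('n)"
  proof (rule le_power_if_le_scaled_log)
    fix \<kappa> :: real assume k: "\<kappa> > 0"
    have q: "\<theta> * M \<le> \<theta> * \<phi> z + R / 2 * (norm (y - z))\<^sup>2" if "y \<in> B" for y z
    proof (cases "\<phi> z = M")
      case True
      then show ?thesis using R_pos by simp
    next
      case False
      then have phi: "\<phi> z = R / 2 * (infdist z A)\<^sup>2" by (auto simp: \<phi>_def min_def split: if_splits)
      have "r \<le> infdist y A"
        using \<open>A \<noteq> {}\<close> far[OF _ that]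
        by (auto simp: infdist_def dist_norm norm_minus_commute less_imp_le intro!: cINF_greatest)
      also have "\<dots> \<le> infdist z A + norm (y - z)"
        using infdist_triangle[of y A z] by (simp add: dist_norm)
      finally have "\<theta> / (1 + \<theta>) * r\<^sup>2 \<le> \<theta> * (infdist z A)\<^sup>2 + (norm (y - z))\<^sup>2"
        using \<theta> r_pos by (intro weighted_square_triangle) auto
      then have "R / 2 * (\<theta> / (1 + \<theta>) * r\<^sup>2) \<le> R / 2 * (\<theta> * (infdist z A)\<^sup>2 + (norm (y - z))\<^sup>2)"
        using R_pos by (intro mult_left_mono) auto
      moreover have "R / 2 * (\<theta> / (1 + \<theta>) * r\<^sup>2) = \<theta> * M"
        using c_pos r_pos by (simp add: \<theta>_def M_def power2_eq_square field_simps)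
      ultimately show ?thesis by (simp add: phi algebra_simps)
    qed
    have "\<bar>\<theta> * \<phi> x\<bar> \<le> \<theta> * M" for x using \<phi>[of x] \<theta> by (simp add: abs_mult)
    then have "ln \<beta> + (1 - \<kappa>) * D \<le> \<kappa> * ((\<integral>x. \<theta> * \<phi> x \<partial>\<mu>) - \<theta> * M) + ?n * (\<kappa> - 1 - ln \<kappa>)"
      using dual_transport_inequality[where \<kappa> = \<kappa> and f = "\<lambda>x. \<theta> * \<phi> x" and B = "\<theta> * M" and S = B
          and q = "\<theta> * M", OF mu_density muR Vm conv R_pos Vi] q k B(1) \<beta>
      by (simp add: \<beta>_def[symmetric] D_def V_r c_V_def)
    also have "(\<integral>x. \<theta> * \<phi> x \<partial>\<mu>) - \<theta> * M \<le> - W"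
      using \<phi>L \<theta> W by (simp add: mult_left_mono algebra_simps)
    finally have "ln \<beta> + (1 - \<kappa>) * D \<le> \<kappa> * (- W) + ?n * (\<kappa> - 1 - ln \<kappa>)"
      using k by (simp add: mult_left_mono)
    moreover have "?n * (\<kappa> * ?X - 1 - ln \<kappa>) = \<kappa> * (?n + (D - W)) - ?n - ?n * ln \<kappa>"
      by (simp add: field_simps)
    ultimately show "ln \<beta> + D \<le> ?n * (\<kappa> * ?X - 1 - ln \<kappa>)"
      by (simp add: algebra_simps)
  qed simp
  then have "exp (- D) * (\<beta> * exp D) \<le> exp (- D) * ?X ^ CARD('n)"
    using \<beta> by (intro mult_left_mono) (auto simp: exp_add)
  then have "\<beta> \<le> exp (- D) * ?X ^ CARD('n)"
    by (simp add: exp_minus field_simps)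
  then show ?thesis
    using B(3) by (simp add: \<beta>_def D_def W_def)
qed

end
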